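(* Let $d \ge 1$ be an integer. There exists a function $\alpha \mapsto \beta(\alpha,d)$ from $(0,1]$ to $(0,1]$ with $\beta(\alpha,d) \to 1$ as $\alpha \to 1$ such that the following holds for every $\alpha \in (0,1]$. Let $\mathcal{F}_1,\mathcal{F}_2,\dots,\mathcal{F}_{d+1}$ be finite, non-empty families of convex sets in $\mathbb{R}^d$. If at least $\alpha|\mathcal{F}_1|\cdots|\mathcal{F}_{d+1}|$ of the colorful $(d+1)$-tuples are intersecting, then for some $1\leq i\leq d+1$, the family $\mathcal{F}_i$ contains an intersecting subfamily of size at least $\beta(\alpha,d)\,|\mathcal{F}_i|$.
   Context: The families $\mathcal{F}_1,\dots,\mathcal{F}_{d+1}$ are called color classes. A colorful $(d+1)$-tuple is a choice $(K_1,\dots,K_{d+1})$ of one member $K_i\in\mathcal{F}_i$ from each color class, so there are $|\mathcal{F}_1|\cdots|\mathcal{F}_{d+1}|$ colorful $(d+1)$-tuples in total. A family (or tuple) of sets is intersecting if the intersection of all its members is non-empty. Families may contain repeated members (they are regarded as indexed families, and sizes are counted with multiplicity), and different color classes may share sets (they are treated as disjoint by color). *)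

theory Defs
  imports "HOL-Analysis.Analysis"
begin

text \<open>
  A finite family of sets is an indexed family: a finite index set \<open>J\<close> together with a
  function \<open>K\<close> giving the member \<open>K j\<close> for each \<open>j \<in> J\<close>. Distinct indices may carry the same
  set, and the size of the family is \<open>card J\<close>, so members are counted with multiplicity.
  A subfamily is given by a subset of the index set.
\<close>

definition intersecting :: "'i set \<Rightarrow> ('i \<Rightarrow> 'a set) \<Rightarrow> bool" where
  "intersecting J K \<longleftrightarrow> (\<Inter>j\<in>J. K j) \<noteq> {}"

text \<open>
  For color classes with index sets \<open>J c\<close>, where \<open>c\<close> ranges over the set \<open>C\<close> of colors, a
  colorful tuple picks one index \<open>t c \<in> J c\<close> for each color; its members are the sets
  \<open>F c (t c)\<close>. Since the choice function records indices and not sets, repeated members and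
  sets shared by several color classes are kept apart.
\<close>

definition colorful_tuples :: "'c set \<Rightarrow> ('c \<Rightarrow> 'i set) \<Rightarrow> ('c \<Rightarrow> 'i) set" where
  "colorful_tuples C J = (\<Pi>\<^sub>E c\<in>C. J c)"

definition intersecting_colorful_tuples ::
    "'c set \<Rightarrow> ('c \<Rightarrow> 'i set) \<Rightarrow> ('c \<Rightarrow> 'i \<Rightarrow> 'a set) \<Rightarrow> ('c \<Rightarrow> 'i) set" where
  "intersecting_colorful_tuples C J F =
     {t \<in> colorful_tuples C J. intersecting C (\<lambda>c. F c (t c))}"

end

theory Submission
  imports Defs
begin

text \<open>
  Two lower bounds for \<open>\<beta>\<close> are combined: \<open>\<alpha> / (d + 1)\<close>, which is positive for every
  \<open>\<alpha> > 0\<close> but stays away from \<open>1\<close>, and \<open>1 - (d + 1) (1 - \<alpha>)\<^bsup>1/(d + 1)\<^esup>\<close>, which tends to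
  \<open>1\<close> but is negative for small \<open>\<alpha>\<close>. The function \<open>\<beta>\<close> is their maximum.

  Both rest on one geometric fact (\<open>nearest_common_omit\<close>): if \<open>d + 1\<close> closed convex sets in
  dimension \<open>d\<close> have a common point, then their common point nearest to the origin is already
  the nearest common point of some \<open>d\<close> of them. The members are first replaced by polytopes
  spanned by witness points (\<open>closed_witness_family\<close>), so that nearest points exist.

  For the first bound (\<open>card_intersecting_tuples_le\<close>), an intersecting colorful tuple is thus
  determined by a color \<open>i\<close>, its \<open>d\<close> entries of the other colors, and an entry of color \<open>i\<close>
  whose set contains a point that depends on these \<open>d\<close> entries only. For fixed \<open>d\<close> entries the
  admissible entries of color \<open>i\<close> form an intersecting subfamily, so if all such subfamilies are
  small then there are few intersecting tuples.

  For the second bound (\<open>prod_deficiency_le\<close>), the same fact yields the colorful Helly theorem of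
  Lovasz. If no large part of \<open>\<F>\<^sub>i\<close> is intersecting, then by Helly's theorem one can split off
  many pairwise disjoint non-intersecting groups of at most \<open>d + 1\<close> members from each \<open>\<F>\<^sub>i\<close>.
  Choosing one group per color, the colorful Helly theorem provides a non-intersecting colorful
  tuple with entries in these groups. Disjointness makes these tuples distinct, so
  there are many non-intersecting tuples. This argument is due to Minki Kim.
\<close>

section \<open>Intersecting families and their depth\<close>

lemma intersecting_iff: "intersecting J K \<longleftrightarrow> (\<exists>x. \<forall>j\<in>J. x \<in> K j)"
  unfolding intersecting_def by auto

lemma intersecting_subset: "intersecting J K \<Longrightarrow> I \<subseteq> J \<Longrightarrow> intersecting I K"
  unfolding intersecting_iff by blast

definition depth :: "'i set \<Rightarrow> ('i \<Rightarrow> 'a set) \<Rightarrow> nat" where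
  "depth J K = Max (card ` {S. S \<subseteq> J \<and> intersecting S K})"

lemma card_le_depth:
  assumes "finite J" "S \<subseteq> J" "intersecting S K"
  shows "card S \<le> depth J K"
  unfolding depth_def using assms by (intro Max_ge) auto

lemma depth_attained:
  assumes "finite J"
  obtains S where "S \<subseteq> J" "intersecting S K" "card S = depth J K"
proof -
  have "{} \<in> {S. S \<subseteq> J \<and> intersecting S K}"
    by (simp add: intersecting_iff)
  then have "depth J K \<in> card ` {S. S \<subseteq> J \<and> intersecting S K}"
    unfolding depth_def using assms by (intro Max_in) (simp, blast)
  then obtain S where "S \<subseteq> J" "intersecting S K" "card S = depth J K" by auto
  then show ?thesis by (rule that)
qed

lemma depth_le_card:
  assumes "finite J"
  shows "depth J K \<le> card J"
proof -
  obtain S where "S \<subseteq> J" "card S = depth J K"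
    using assms by (rule depth_attained)
  then show ?thesis using card_mono[OF assms, of S] by simp
qed

text \<open>
  The theorem \<open>Helly\<close> speaks of sets of sets. A family with repeated members is handled
  through index sets on which \<open>K\<close> is injective.
\<close>

lemma Helly_intersecting:
  fixes K :: "'i \<Rightarrow> 'a::euclidean_space set"
  assumes "finite J" and conv: "\<And>j. j \<in> J \<Longrightarrow> convex (K j)"
    and small: "\<And>T. T \<subseteq> J \<Longrightarrow> card T \<le> DIM('a) + 1 \<Longrightarrow> intersecting T K"
  shows "intersecting J K"
proof (cases "card (K ` J) \<ge> DIM('a) + 1")
  case True
  have "\<Inter>(K ` J) \<noteq> {}"
  proof (rule Helly[OF True])
    show "\<forall>s\<in>K ` J. convex s" using conv by auto
    fix t assume t: "t \<subseteq> K ` J" "card t = DIM('a) + 1"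
    then obtain T where T: "T \<subseteq> J" "inj_on K T" "t = K ` T"
      by (auto simp: subset_image_inj)
    then have "card T = DIM('a) + 1"
      using t(2) card_image[OF T(2)] by simp
    with T(3) small[OF T(1)] show "\<Inter>t \<noteq> {}"
      by (simp add: intersecting_def)
  qed
  then show ?thesis by (simp add: intersecting_def)
next
  case False
  obtain T where T: "T \<subseteq> J" "inj_on K T" "K ` J = K ` T"
    using subset_image_inj[of "K ` J" K J, THEN iffD1, OF subset_refl] by (elim exE conjE)
  have "card T \<le> DIM('a) + 1"
    using False card_image[OF T(2)] T(3) by simp
  with T(3) small[OF T(1)] show ?thesis
    by (simp add: intersecting_def)
qed

section \<open>The common point nearest to the origin\<close>

definition nearest_common :: "'i set \<Rightarrow> ('i \<Rightarrow> 'a::euclidean_space set) \<Rightarrow> 'a" where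
  "nearest_common I K = closest_point (\<Inter>i\<in>I. K i) 0"

lemma nearest_common_cong:
  "(\<And>i. i \<in> I \<Longrightarrow> K i = L i) \<Longrightarrow> nearest_common I K = nearest_common I L"
  unfolding nearest_common_def by (simp cong: INF_cong)

lemma nearest_common_in:
  assumes "intersecting I K" "\<And>i. i \<in> I \<Longrightarrow> closed (K i)" "i \<in> I"
  shows "nearest_common I K \<in> K i"
proof -
  have "closed (\<Inter>i\<in>I. K i)" using assms by blast
  then have "nearest_common I K \<in> (\<Inter>i\<in>I. K i)"
    unfolding nearest_common_def using assms(1)
    by (intro closest_point_in_set) (auto simp: intersecting_def)
  then show ?thesis using assms(3) by blast
qed

lemma norm_nearest_common_le:
  assumes "\<And>i. i \<in> I \<Longrightarrow> closed (K i)" "\<And>i. i \<in> I \<Longrightarrow> x \<in> K i"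
  shows "norm (nearest_common I K) \<le> norm x"
proof -
  have "closed (\<Inter>i\<in>I. K i)" "x \<in> (\<Inter>i\<in>I. K i)" using assms by blast+
  from closest_point_le[OF this, of 0] show ?thesis
    unfolding nearest_common_def by simp
qed

lemma nearest_common_unique:
  assumes "\<And>i. i \<in> I \<Longrightarrow> closed (K i)" "\<And>i. i \<in> I \<Longrightarrow> convex (K i)"
    and "\<And>i. i \<in> I \<Longrightarrow> x \<in> K i" and "norm x \<le> norm (nearest_common I K)"
  shows "x = nearest_common I K"
  unfolding nearest_common_def
proof (rule closest_point_unique)
  show "convex (\<Inter>i\<in>I. K i)" using assms(2) by (intro convex_INT) auto
  show "closed (\<Inter>i\<in>I. K i)" "x \<in> (\<Inter>i\<in>I. K i)" using assms(1,3) by blast+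
  show "\<forall>z\<in>\<Inter>i\<in>I. K i. dist 0 x \<le> dist 0 z"
    using norm_nearest_common_le[of I K] assms(1,4) by (force intro: order_trans)
qed

text \<open>
  Together with the open ball around the origin whose boundary passes through the nearest
  common point, the \<open>d + 1\<close> sets form \<open>d + 2\<close> convex sets without a common point. By Helly's
  theorem some \<open>d + 1\<close> of these have no common point, and the ball must be among them because
  the given sets do intersect. Hence the other \<open>d\<close> sets have no common point closer to the
  origin, and the nearest point of a closed convex set is unique.
\<close>

lemma nearest_common_omit:
  fixes K :: "'c \<Rightarrow> 'a::euclidean_space set"
  assumes C: "finite C" "card C = DIM('a) + 1"
    and cl: "\<And>c. c \<in> C \<Longrightarrow> closed (K c)" and conv: "\<And>c. c \<in> C \<Longrightarrow> convex (K c)"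
    and int: "intersecting C K"
  shows "\<exists>i\<in>C. nearest_common (C - {i}) K = nearest_common C K"
proof -
  define p where "p = nearest_common C K"
  have p: "p \<in> K c" if "c \<in> C" for c
    unfolding p_def using nearest_common_in[OF int cl] that by blast
  define D where "D = insert None (Some ` C)"
  define L where "L = case_option (ball 0 (norm p)) K"
  have "finite D" using C by (simp add: D_def)
  have "card D = card C + 1"
    using C by (simp add: D_def card_image)
  have "\<not> intersecting D L"
  proof
    assume "intersecting D L"
    then obtain x where x: "\<forall>j\<in>D. x \<in> L j" by (auto simp: intersecting_iff)
    then have "norm x < norm p" "\<And>c. c \<in> C \<Longrightarrow> x \<in> K c"
      by (auto simp: D_def L_def)
    with norm_nearest_common_le[of C K x] cl show False
      by (force simp: p_def)
  qed
  moreover have "convex (L j)" if "j \<in> D" for j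
    using that conv by (auto simp: D_def L_def)
  ultimately obtain T where T: "T \<subseteq> D" "card T \<le> card C" "\<not> intersecting T L"
    using Helly_intersecting[OF \<open>finite D\<close>, of L] C by metis
  then have "T \<noteq> D" using \<open>card D = card C + 1\<close> by auto
  moreover have "None \<in> T"
  proof (rule ccontr)
    assume "None \<notin> T"
    then have "\<forall>j\<in>T. p \<in> L j" using T(1) p by (auto simp: D_def L_def)
    with T(3) show False by (auto simp: intersecting_iff)
  qed
  ultimately obtain i where i: "i \<in> C" "Some i \<notin> T"
    using T(1) by (auto simp: D_def)
  let ?q = "nearest_common (C - {i}) K"
  have int': "intersecting (C - {i}) K"
    using int by (rule intersecting_subset) auto
  have q: "?q \<in> K c" if "c \<in> C - {i}" for c
    using nearest_common_in[OF int' _ that] cl by blast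
  have "norm p \<le> norm ?q"
  proof (rule ccontr)
    assume "\<not> norm p \<le> norm ?q"
    then have "\<forall>j\<in>T. ?q \<in> L j"
      using T(1) i q by (auto simp: D_def L_def split: option.split)
    with T(3) show False by (auto simp: intersecting_iff)
  qed
  moreover have "norm ?q \<le> norm p"
    using cl p by (intro norm_nearest_common_le) auto
  ultimately have "p = ?q"
    using cl conv p by (intro nearest_common_unique) auto
  then show ?thesis unfolding p_def by (intro bexI[OF sym i(1)])
qed

section \<open>The colorful Helly theorem\<close>

text \<open>
  Among all choices of \<open>d\<close> entries of distinct colors take one whose nearest common point \<open>q\<close> is
  farthest from the origin; let \<open>i\<close> be the omitted color. Adding any member of color \<open>i\<close> can only
  move the nearest common point away from the origin, but the new point is again the nearest
  common point of some \<open>d\<close> entries, so by maximality it equals \<open>q\<close>. Hence \<open>q\<close> lies in every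
  member of color \<open>i\<close>.
\<close>

theorem colorful_Helly:
  fixes F :: "'c \<Rightarrow> 'i \<Rightarrow> 'a::euclidean_space set"
  assumes C: "finite C" "card C = DIM('a) + 1"
    and J: "\<And>c. c \<in> C \<Longrightarrow> finite (J c)" "\<And>c. c \<in> C \<Longrightarrow> J c \<noteq> {}"
    and cl: "\<And>c j. c \<in> C \<Longrightarrow> j \<in> J c \<Longrightarrow> closed (F c j)"
    and conv: "\<And>c j. c \<in> C \<Longrightarrow> j \<in> J c \<Longrightarrow> convex (F c j)"
    and int: "\<And>t. t \<in> colorful_tuples C J \<Longrightarrow> intersecting C (\<lambda>c. F c (t c))"
  obtains i where "i \<in> C" "intersecting (J i) (F i)"
proof -
  define q where "q = (\<lambda>(i, t). nearest_common (C - {i}) (\<lambda>c. F c (t c)))"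
  have fin: "finite (C \<times> colorful_tuples C J)"
    using C J unfolding colorful_tuples_def by (intro finite_cartesian_product finite_PiE) auto
  have "C \<times> colorful_tuples C J \<noteq> {}"
    using C J(2) by (auto simp: colorful_tuples_def PiE_eq_empty_iff)
  with fin have "Max ((\<lambda>y. norm (q y)) ` (C \<times> colorful_tuples C J))
      \<in> (\<lambda>y. norm (q y)) ` (C \<times> colorful_tuples C J)"
    by (intro Max_in) auto
  then obtain z where z: "z \<in> C \<times> colorful_tuples C J"
    and Max_eq: "Max ((\<lambda>y. norm (q y)) ` (C \<times> colorful_tuples C J)) = norm (q z)"
    by blast
  have z_max: "norm (q y) \<le> norm (q z)" if "y \<in> C \<times> colorful_tuples C J" for y
    unfolding Max_eq[symmetric] using fin that by (intro Max_ge) auto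
  obtain i t where it: "z = (i, t)" "i \<in> C" "t \<in> colorful_tuples C J"
    using z by auto
  have "q z \<in> F i j" if j: "j \<in> J i" for j
  proof -
    define u where "u = t(i := j)"
    have u: "u \<in> colorful_tuples C J"
      using it j unfolding u_def colorful_tuples_def by (auto simp: PiE_iff extensional_def)
    then have uJ: "u c \<in> J c" if "c \<in> C" for c
      using that by (auto simp: colorful_tuples_def)
    have qu: "q z = nearest_common (C - {i}) (\<lambda>c. F c (u c))"
      unfolding it q_def u_def by (auto intro!: nearest_common_cong)
    define p where "p = nearest_common C (\<lambda>c. F c (u c))"
    have p: "p \<in> F c (u c)" if "c \<in> C" for c
      unfolding p_def
      by (rule nearest_common_in[OF int[OF u] _ that]) (simp add: cl uJ)
    have "\<exists>k\<in>C. nearest_common (C - {k}) (\<lambda>c. F c (u c)) = p"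
      unfolding p_def
      by (rule nearest_common_omit[OF C _ _ int[OF u]]) (simp_all add: cl conv uJ)
    then obtain k where k: "k \<in> C" "nearest_common (C - {k}) (\<lambda>c. F c (u c)) = p" ..
    then have "norm p \<le> norm (q z)"
      using z_max[of "(k, u)"] u by (simp add: q_def)
    then have "p = q z"
      unfolding qu by (intro nearest_common_unique) (simp_all add: cl conv uJ p)
    with p[OF it(2)] show ?thesis by (simp add: u_def)
  qed
  then have "intersecting (J i) (F i)" unfolding intersecting_iff by blast
  then show ?thesis by (rule that[OF it(2)])
qed

section \<open>Few intersecting tuples if all depths are small\<close>

text \<open>
  By \<open>nearest_common_omit\<close> an intersecting tuple arises from a color \<open>i\<close>, a choice \<open>s\<close> of entries
  of the other colors, and an entry of color \<open>i\<close> whose set contains the nearest common point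
  \<open>q i s\<close>. For fixed \<open>s\<close> these last entries share the point \<open>q i s\<close>, so their number is at most
  the depth of class \<open>i\<close>.
\<close>

lemma card_intersecting_tuples_le:
  fixes F :: "'c \<Rightarrow> 'i \<Rightarrow> 'a::euclidean_space set"
  assumes C: "finite C" "card C = DIM('a) + 1"
    and J: "\<And>c. c \<in> C \<Longrightarrow> finite (J c)"
    and cl: "\<And>c j. c \<in> C \<Longrightarrow> j \<in> J c \<Longrightarrow> closed (F c j)"
    and conv: "\<And>c j. c \<in> C \<Longrightarrow> j \<in> J c \<Longrightarrow> convex (F c j)"
  shows "card (intersecting_colorful_tuples C J F)
           \<le> (\<Sum>i\<in>C. (\<Prod>c\<in>C - {i}. card (J c)) * depth (J i) (F i))"
proof -
  define q where "q i s = nearest_common (C - {i}) (\<lambda>c. F c (s c))" for i s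
  define S where "S i s = {j \<in> J i. q i s \<in> F i j}" for i s
  define P where "P i = (\<Pi>\<^sub>E c\<in>C - {i}. J c)" for i
  define U where "U i = (\<lambda>(s, j). s(i := j)) ` Sigma (P i) (S i)" for i
  have finP: "finite (P i)" for i
    unfolding P_def using C J by (intro finite_PiE) auto
  have finS: "finite (S i s)" if "i \<in> C" for i s
    using J[OF that] by (simp add: S_def)
  have finU: "finite (U i)" if "i \<in> C" for i
    unfolding U_def using finP finS[OF that] by (intro finite_imageI finite_SigmaI)
  have "intersecting_colorful_tuples C J F \<subseteq> (\<Union>i\<in>C. U i)"
  proof
    fix t assume "t \<in> intersecting_colorful_tuples C J F"
    then have t: "t \<in> Pi\<^sub>E C J" and int: "intersecting C (\<lambda>c. F c (t c))"
      by (auto simp: intersecting_colorful_tuples_def colorful_tuples_def)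
    have tJ: "t c \<in> J c" if "c \<in> C" for c using t that by auto
    have "\<exists>i\<in>C. nearest_common (C - {i}) (\<lambda>c. F c (t c)) = nearest_common C (\<lambda>c. F c (t c))"
      by (rule nearest_common_omit[OF C _ _ int]) (simp_all add: cl conv tJ)
    then obtain i where i: "i \<in> C"
      and eq: "nearest_common (C - {i}) (\<lambda>c. F c (t c)) = nearest_common C (\<lambda>c. F c (t c))" ..
    \<comment> \<open>Elements of \<open>P i\<close> take the value \<open>undefined\<close> at the omitted color.\<close>
    define s where "s = t(i := undefined)"
    have "q i s = nearest_common C (\<lambda>c. F c (t c))"
      unfolding q_def eq[symmetric] by (rule nearest_common_cong) (simp add: s_def)
    then have "q i s \<in> F i (t i)"
      using nearest_common_in[OF int, of i] cl tJ i by auto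
    moreover have "s \<in> P i"
      using t unfolding s_def P_def by (auto simp: PiE_iff extensional_def)
    ultimately have "(s, t i) \<in> Sigma (P i) (S i)"
      using tJ i by (simp add: S_def)
    moreover have "t = s(i := t i)" by (simp add: s_def)
    ultimately show "t \<in> (\<Union>i\<in>C. U i)"
      using i unfolding U_def by (intro UN_I[of i] image_eqI[of _ _ "(s, t i)"]) auto
  qed
  then have "card (intersecting_colorful_tuples C J F) \<le> card (\<Union>i\<in>C. U i)"
    using finU C by (intro card_mono) auto
  also have "\<dots> \<le> (\<Sum>i\<in>C. card (U i))"
    using C by (intro card_UN_le)
  also have "\<dots> \<le> (\<Sum>i\<in>C. (\<Prod>c\<in>C - {i}. card (J c)) * depth (J i) (F i))"
  proof (rule sum_mono)
    fix i assume i: "i \<in> C"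
    have "card (U i) \<le> card (Sigma (P i) (S i))"
      unfolding U_def using finP finS[OF i] by (intro card_image_le finite_SigmaI)
    also have "\<dots> = (\<Sum>s\<in>P i. card (S i s))"
      using finP finS[OF i] by (simp add: card_SigmaI)
    also have "\<dots> \<le> (\<Sum>s\<in>P i. depth (J i) (F i))"
      using J[OF i] by (intro sum_mono card_le_depth) (auto simp: S_def intersecting_iff)
    also have "\<dots> = (\<Prod>c\<in>C - {i}. card (J c)) * depth (J i) (F i)"
      unfolding P_def using C by (simp add: card_PiE)
    finally show "card (U i) \<le> (\<Prod>c\<in>C - {i}. card (J c)) * depth (J i) (F i)" .
  qed
  finally show ?thesis .
qed

section \<open>Many non-intersecting tuples if all depths are small\<close>

text \<open>
  By Helly's theorem, as long as the remaining members are not intersecting, a further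
  non-intersecting group of at most \<open>d + 1\<close> members can be split off.
\<close>

lemma disjoint_nonintersecting_groups:
  fixes K :: "'i \<Rightarrow> 'a::euclidean_space set"
  assumes "finite J" "\<And>j. j \<in> J \<Longrightarrow> convex (K j)"
  obtains G where "finite G" "disjoint G" "\<Union>G \<subseteq> J" "intersecting (J - \<Union>G) K"
    "\<And>g. g \<in> G \<Longrightarrow> \<not> intersecting g K" "\<And>g. g \<in> G \<Longrightarrow> card g \<le> DIM('a) + 1"
proof -
  have "\<exists>G. finite G \<and> disjoint G \<and> \<Union>G \<subseteq> J \<and> intersecting (J - \<Union>G) K
      \<and> (\<forall>g\<in>G. \<not> intersecting g K \<and> card g \<le> DIM('a) + 1)"
    using assms
  proof (induction J rule: finite_psubset_induct)
    case (psubset J)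
    show ?case
    proof (cases "intersecting J K")
      case True
      then show ?thesis by (intro exI[of _ "{}"]) auto
    next
      case False
      then obtain g where g: "g \<subseteq> J" "card g \<le> DIM('a) + 1" "\<not> intersecting g K"
        using Helly_intersecting[OF psubset.hyps(1), of K] psubset.prems by metis
      then have "g \<noteq> {}" by (auto simp: intersecting_iff)
      with g have "J - g \<subset> J" by blast
      then have "\<exists>G. finite G \<and> disjoint G \<and> \<Union>G \<subseteq> J - g \<and> intersecting (J - g - \<Union>G) K
          \<and> (\<forall>g\<in>G. \<not> intersecting g K \<and> card g \<le> DIM('a) + 1)"
        by (rule psubset.IH) (use psubset.prems in auto)
      then obtain G where
        G: "finite G" "disjoint G" "\<Union>G \<subseteq> J - g" "intersecting (J - g - \<Union>G) K"
          "\<forall>g\<in>G. \<not> intersecting g K \<and> card g \<le> DIM('a) + 1"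
        by (elim exE conjE)
      have "J - \<Union>(insert g G) = J - g - \<Union>G" by auto
      moreover have "disjoint (insert g G)"
        using G(2,3) by (auto simp: disjoint_def pairwise_def disjnt_def)
      ultimately show ?thesis
        using G g by (intro exI[of _ "insert g G"] conjI) (simp_all, blast)
    qed
  qed
  then show ?thesis using that by (elim exE conjE) simp
qed

lemma card_minus_depth_le:
  assumes "finite J" "\<Union>G \<subseteq> J" "finite G" "intersecting (J - \<Union>G) K"
    and "\<And>g. g \<in> G \<Longrightarrow> card g \<le> n"
  shows "card J \<le> depth J K + n * card G"
proof -
  have "card J = card (J - \<Union>G) + card (\<Union>G)"
    using assms(1,2) by (metis Un_Diff_cancel2 card_Un_disjoint Diff_disjoint finite_Diff
        finite_subset inf_commute sup.absorb1)
  moreover have "card (J - \<Union>G) \<le> depth J K"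
    using assms by (intro card_le_depth) auto
  moreover have "card (\<Union>G) \<le> n * card G"
  proof -
    have "card (\<Union>G) \<le> (\<Sum>g\<in>G. card g)"
      using card_UN_le[OF assms(3), of "\<lambda>g. g"] by simp
    also have "\<dots> \<le> n * card G"
      using sum_bounded_above[of G card n] assms(5) by (simp add: mult.commute)
    finally show ?thesis .
  qed
  ultimately show ?thesis by linarith
qed

text \<open>
  Every choice of one non-intersecting group per color contains a non-intersecting colorful
  tuple, by the colorful Helly theorem. As the groups of one color are disjoint, the tuple
  determines the groups it was taken from. Hence the product of the numbers of groups bounds
  the number of non-intersecting tuples from below. The groups of color \<open>c\<close> leave
  out at most \<open>depth (J c) (F c)\<close> members and have at most \<open>d + 1\<close> members each, whence the
  constant.
\<close>

lemma prod_deficiency_le: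
  fixes F :: "'c \<Rightarrow> 'i \<Rightarrow> 'a::euclidean_space set"
  assumes C: "finite C" "card C = DIM('a) + 1"
    and J: "\<And>c. c \<in> C \<Longrightarrow> finite (J c)"
    and cl: "\<And>c j. c \<in> C \<Longrightarrow> j \<in> J c \<Longrightarrow> closed (F c j)"
    and conv: "\<And>c j. c \<in> C \<Longrightarrow> j \<in> J c \<Longrightarrow> convex (F c j)"
  shows "(\<Prod>c\<in>C. card (J c) - depth (J c) (F c))
           \<le> (DIM('a) + 1) ^ (DIM('a) + 1) *
              card (colorful_tuples C J - intersecting_colorful_tuples C J F)"
proof -
  let ?n = "DIM('a) + 1"
  let ?N = "colorful_tuples C J - intersecting_colorful_tuples C J F"
  have "\<forall>c\<in>C. \<exists>G. finite G \<and> disjoint G \<and> \<Union>G \<subseteq> J c \<and> intersecting (J c - \<Union>G) (F c)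
      \<and> (\<forall>g\<in>G. \<not> intersecting g (F c) \<and> card g \<le> ?n)"
  proof
    fix c assume c: "c \<in> C"
    show "\<exists>G. finite G \<and> disjoint G \<and> \<Union>G \<subseteq> J c \<and> intersecting (J c - \<Union>G) (F c)
        \<and> (\<forall>g\<in>G. \<not> intersecting g (F c) \<and> card g \<le> ?n)"
      by (rule disjoint_nonintersecting_groups[OF J[OF c] conv[OF c]], assumption) blast
  qed
  then obtain G where G: "\<And>c. c \<in> C \<Longrightarrow> finite (G c) \<and> disjoint (G c) \<and> \<Union>(G c) \<subseteq> J c
      \<and> intersecting (J c - \<Union>(G c)) (F c) \<and> (\<forall>g\<in>G c. \<not> intersecting g (F c) \<and> card g \<le> ?n)"
    by (metis (no_types, lifting))
  have "\<exists>t. t \<in> ?N \<and> (\<forall>c\<in>C. t c \<in> h c)" if h: "h \<in> Pi\<^sub>E C G" for h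
  proof (rule ccontr)
    assume none: "\<nexists>t. t \<in> ?N \<and> (\<forall>c\<in>C. t c \<in> h c)"
    have hJ: "h c \<subseteq> J c" and hn: "\<not> intersecting (h c) (F c)" if "c \<in> C" for c
      using h G[OF that] that by (auto simp: PiE_iff)
    have "intersecting C (\<lambda>c. F c (t c))" if "t \<in> colorful_tuples C h" for t
    proof -
      have "t \<in> colorful_tuples C J" "\<forall>c\<in>C. t c \<in> h c"
        using that hJ unfolding colorful_tuples_def by (auto simp: PiE_iff)
      with none show ?thesis by (auto simp: intersecting_colorful_tuples_def)
    qed
    moreover have "finite (h c)" "h c \<noteq> {}" if "c \<in> C" for c
      using hJ[OF that] hn[OF that] J[OF that]
      by (auto intro: finite_subset simp: intersecting_iff)
    ultimately obtain i where "i \<in> C" "intersecting (h i) (F i)"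
      using colorful_Helly[OF C, of h F] cl conv hJ by blast
    with hn show False by blast
  qed
  then obtain f where f: "\<And>h. h \<in> Pi\<^sub>E C G \<Longrightarrow> f h \<in> ?N"
    and fh: "\<And>h c. h \<in> Pi\<^sub>E C G \<Longrightarrow> c \<in> C \<Longrightarrow> f h c \<in> h c"
    by metis
  have "inj_on f (Pi\<^sub>E C G)"
  proof (rule inj_onI)
    fix h k assume hk: "h \<in> Pi\<^sub>E C G" "k \<in> Pi\<^sub>E C G" "f h = f k"
    have "h c = k c" if c: "c \<in> C" for c
    proof -
      have "f h c \<in> h c \<inter> k c" using fh[OF hk(1) c] fh[OF hk(2) c] hk(3) by simp
      moreover have "h c \<in> G c" "k c \<in> G c" using hk c by auto
      ultimately show ?thesis using G[OF c] by (auto simp: disjoint_def)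
    qed
    then show "h = k" using hk by (intro PiE_ext)
  qed
  moreover have "finite ?N"
    unfolding colorful_tuples_def using C J by (intro finite_Diff finite_PiE)
  ultimately have "card (Pi\<^sub>E C G) \<le> card ?N"
    using f by (intro card_inj_on_le) auto
  then have "(\<Prod>c\<in>C. card (G c)) \<le> card ?N"
    using C by (simp add: card_PiE)
  have "(\<Prod>c\<in>C. card (J c) - depth (J c) (F c)) \<le> (\<Prod>c\<in>C. ?n * card (G c))"
  proof (rule prod_mono)
    fix c assume c: "c \<in> C"
    then have "card (J c) \<le> depth (J c) (F c) + ?n * card (G c)"
      using G J by (intro card_minus_depth_le) auto
    then show "0 \<le> card (J c) - depth (J c) (F c) \<and>
        card (J c) - depth (J c) (F c) \<le> ?n * card (G c)" by auto
  qed
  also have "\<dots> = ?n ^ ?n * (\<Prod>c\<in>C. card (G c))"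
    unfolding prod.distrib using C by simp
  also have "\<dots> \<le> ?n ^ ?n * card ?N"
    using \<open>(\<Prod>c\<in>C. card (G c)) \<le> card ?N\<close> by (rule mult_left_mono) simp
  finally show ?thesis .
qed

section \<open>Reduction to closed sets\<close>

text \<open>
  Choose a common point for each intersecting colorful tuple and replace every member by the
  convex hull of the points chosen for the tuples through it. Members shrink, so
  an intersecting subfamily of the new family is intersecting in the old one, while no
  intersecting colorful tuple is lost.
\<close>

lemma closed_witness_family:
  fixes F :: "'c \<Rightarrow> 'i \<Rightarrow> 'a::euclidean_space set"
  assumes C: "finite C" and J: "\<And>c. c \<in> C \<Longrightarrow> finite (J c)"
    and conv: "\<And>c j. c \<in> C \<Longrightarrow> j \<in> J c \<Longrightarrow> convex (F c j)"
  obtains A where "\<And>c j. closed (A c j)" "\<And>c j. convex (A c j)"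
    "\<And>c j. c \<in> C \<Longrightarrow> j \<in> J c \<Longrightarrow> A c j \<subseteq> F c j"
    "intersecting_colorful_tuples C J A = intersecting_colorful_tuples C J F"
proof -
  let ?T = "intersecting_colorful_tuples C J F"
  have "finite (colorful_tuples C J)"
    unfolding colorful_tuples_def using C J by (intro finite_PiE)
  then have finT: "finite ?T"
    by (simp add: intersecting_colorful_tuples_def)
  have "\<forall>t\<in>?T. \<exists>x. \<forall>c\<in>C. x \<in> F c (t c)"
    by (auto simp: intersecting_colorful_tuples_def intersecting_iff)
  then obtain x where x: "\<And>t c. t \<in> ?T \<Longrightarrow> c \<in> C \<Longrightarrow> x t \<in> F c (t c)"
    by metis
  define A where "A c j = convex hull (x ` {t \<in> ?T. t c = j})" for c j
  have sub: "A c j \<subseteq> F c j" if "c \<in> C" "j \<in> J c" for c j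
    unfolding A_def using x that conv by (intro hull_minimal) auto
  have "intersecting_colorful_tuples C J A = ?T"
  proof (intro equalityI subsetI)
    fix t assume t: "t \<in> intersecting_colorful_tuples C J A"
    then have "t c \<in> J c" if "c \<in> C" for c
      using that by (auto simp: intersecting_colorful_tuples_def colorful_tuples_def)
    with t sub show "t \<in> ?T"
      unfolding intersecting_colorful_tuples_def intersecting_iff by blast
  next
    fix t assume t: "t \<in> ?T"
    then have "x t \<in> A c (t c)" for c
      unfolding A_def by (intro hull_inc) auto
    with t show "t \<in> intersecting_colorful_tuples C J A"
      unfolding intersecting_colorful_tuples_def intersecting_iff by blast
  qed
  moreover have "closed (A c j)" for c j
    unfolding A_def using finT
    by (intro compact_imp_closed compact_convex_hull finite_imp_compact) auto
  moreover have "convex (A c j)" for c j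
    unfolding A_def by (rule convex_convex_hull)
  ultimately show ?thesis
    using sub by (intro that[of A])
qed

section \<open>The colorful fractional Helly theorem\<close>

text \<open>
  If every depth were below the claimed bound, then, according to which of the two terms is the
  larger, either \<open>card_intersecting_tuples_le\<close> would leave less than the fraction \<open>\<alpha>\<close> of
  intersecting tuples, or \<open>prod_deficiency_le\<close> would produce more than the fraction \<open>1 - \<alpha>\<close> of
  non-intersecting ones.
\<close>

lemma colorful_fractional_Helly_closed:
  fixes F :: "'c \<Rightarrow> 'i \<Rightarrow> 'a::euclidean_space set" and \<alpha> :: real
  defines "n \<equiv> DIM('a) + 1"
  assumes C: "finite C" "card C = n"
    and J: "\<And>c. c \<in> C \<Longrightarrow> finite (J c)" "\<And>c. c \<in> C \<Longrightarrow> J c \<noteq> {}"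
    and cl: "\<And>c j. c \<in> C \<Longrightarrow> j \<in> J c \<Longrightarrow> closed (F c j)"
    and conv: "\<And>c j. c \<in> C \<Longrightarrow> j \<in> J c \<Longrightarrow> convex (F c j)"
    and \<alpha>: "\<alpha> \<le> 1"
    and many: "real (card (intersecting_colorful_tuples C J F)) \<ge> \<alpha> * (\<Prod>c\<in>C. real (card (J c)))"
  obtains i where "i \<in> C"
    "real (depth (J i) (F i)) \<ge> max (\<alpha> / n) (1 - n * root n (1 - \<alpha>)) * card (J i)"
proof (rule ccontr)
  assume "\<not> thesis"
  with that have small:
    "real (depth (J c) (F c)) < max (\<alpha> / n) (1 - n * root n (1 - \<alpha>)) * card (J c)"
    if "c \<in> C" for c using that not_le by blast
  let ?T = "intersecting_colorful_tuples C J F"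
  let ?P = "\<Prod>c\<in>C. real (card (J c))"
  have n: "n > 0" and Cn: "C \<noteq> {}" using C by (auto simp: n_def)
  have Jpos: "real (card (J c)) > 0" if "c \<in> C" for c
    using J that by (simp add: card_gt_0_iff)
  then have "?P > 0" by (intro prod_pos) auto
  show False
  proof (cases "\<alpha> / n \<ge> 1 - n * root n (1 - \<alpha>)")
    case True
    have "real (card ?T) \<le> real (\<Sum>i\<in>C. (\<Prod>c\<in>C - {i}. card (J c)) * depth (J i) (F i))"
      using card_intersecting_tuples_le[of C J F] C J cl conv by (simp add: n_def del: of_nat_sum)
    also have "\<dots> = (\<Sum>i\<in>C. (\<Prod>c\<in>C - {i}. real (card (J c))) * depth (J i) (F i))"
      by simp
    also have "\<dots> < (\<Sum>i\<in>C. (\<Prod>c\<in>C - {i}. real (card (J c))) * (\<alpha> / n * card (J i)))"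
      using small True C Cn Jpos
      by (intro sum_strict_mono mult_strict_left_mono prod_pos) (auto simp: max_def)
    also have "\<dots> = (\<Sum>i\<in>C. \<alpha> / n * ?P)"
      using C by (intro sum.cong) (auto simp: prod.remove mult_ac)
    also have "\<dots> = \<alpha> * ?P"
      using C n by simp
    finally show False using many by simp
  next
    case False
    let ?N = "colorful_tuples C J - ?T"
    have T_sub: "?T \<subseteq> colorful_tuples C J"
      by (auto simp: intersecting_colorful_tuples_def)
    have fin: "finite (colorful_tuples C J)"
      unfolding colorful_tuples_def using C J by (intro finite_PiE)
    have "real (card (colorful_tuples C J)) = ?P"
      unfolding colorful_tuples_def using C by (simp add: card_PiE)
    then have "real (card ?N) = ?P - card ?T"
      using T_sub fin card_mono[OF fin T_sub] finite_subset[OF T_sub fin]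
      by (simp add: card_Diff_subset of_nat_diff)
    with many have few: "real (card ?N) \<le> (1 - \<alpha>) * ?P"
      by (simp add: algebra_simps)
    have "real n ^ n * ((1 - \<alpha>) * ?P) = (\<Prod>c\<in>C. n * root n (1 - \<alpha>) * card (J c))"
      using n \<alpha> C by (simp add: prod.distrib real_root_pow_pos2 mult_ac)
    also have "\<dots> < (\<Prod>c\<in>C. real (card (J c) - depth (J c) (F c)))"
    proof -
      have le: "n * root n (1 - \<alpha>) * card (J c) < real (card (J c) - depth (J c) (F c))"
        and nn: "0 \<le> n * root n (1 - \<alpha>) * card (J c)" if "c \<in> C" for c
      proof -
        show nn: "0 \<le> n * root n (1 - \<alpha>) * card (J c)" using \<alpha> n by simp
        show "n * root n (1 - \<alpha>) * card (J c) < real (card (J c) - depth (J c) (F c))"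
          using small[OF that] False depth_le_card[OF J(1)[OF that], of "F c"]
          by (simp add: max_def of_nat_diff algebra_simps)
      qed
      obtain c where "c \<in> C" using Cn by blast
      then show ?thesis
        using le nn C by (intro prod_mono_strict[of c]) (force intro: less_imp_le)+
    qed
    also have "\<dots> = real (\<Prod>c\<in>C. card (J c) - depth (J c) (F c))" by simp
    also have "\<dots> \<le> real (n ^ n * card ?N)"
      unfolding of_nat_le_iff
      using prod_deficiency_le[of C J F] C J cl conv by (simp add: n_def)
    also have "\<dots> = real n ^ n * card ?N" by simp
    also have "\<dots> \<le> real n ^ n * ((1 - \<alpha>) * ?P)"
      using few by (intro mult_left_mono) auto
    finally show False by simp
  qed
qed

theorem colorful_fractional_Helly:
  fixes F :: "'c \<Rightarrow> 'i \<Rightarrow> 'a::euclidean_space set" and \<alpha> :: real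
  defines "n \<equiv> DIM('a) + 1"
  assumes C: "finite C" "card C = n"
    and J: "\<And>c. c \<in> C \<Longrightarrow> finite (J c)" "\<And>c. c \<in> C \<Longrightarrow> J c \<noteq> {}"
    and conv: "\<And>c j. c \<in> C \<Longrightarrow> j \<in> J c \<Longrightarrow> convex (F c j)"
    and \<alpha>: "\<alpha> \<le> 1"
    and many: "real (card (intersecting_colorful_tuples C J F)) \<ge> \<alpha> * (\<Prod>c\<in>C. real (card (J c)))"
  obtains i S where "i \<in> C" "S \<subseteq> J i" "intersecting S (F i)"
    "real (card S) \<ge> max (\<alpha> / n) (1 - n * root n (1 - \<alpha>)) * card (J i)"
proof -
  obtain A where A: "\<And>c j. closed (A c j)" "\<And>c j. convex (A c j)"
    and sub: "\<And>c j. c \<in> C \<Longrightarrow> j \<in> J c \<Longrightarrow> A c j \<subseteq> F c j"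
    and eq: "intersecting_colorful_tuples C J A = intersecting_colorful_tuples C J F"
    by (rule closed_witness_family[of C J F, OF C(1) J(1) conv]) (assumption+, rule that)
  obtain i where i: "i \<in> C"
    "real (depth (J i) (A i)) \<ge> max (\<alpha> / n) (1 - n * root n (1 - \<alpha>)) * card (J i)"
    using colorful_fractional_Helly_closed[OF C[unfolded n_def] J A \<alpha> many[folded eq]]
    unfolding n_def by blast
  obtain S where S: "S \<subseteq> J i" "intersecting S (A i)" "card S = depth (J i) (A i)"
    by (rule depth_attained[OF J(1)[OF i(1)]])
  have "intersecting S (F i)"
    using S sub[OF i(1)] unfolding intersecting_iff by blast
  moreover have "real (card S) \<ge> max (\<alpha> / n) (1 - n * root n (1 - \<alpha>)) * card (J i)"
    unfolding S(3) by (rule i(2))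
  ultimately show ?thesis
    by (rule that[OF i(1) S(1)])
qed

theorem theorem1p5:
  fixes d :: nat
  assumes "d \<ge> 1" and "CARD('n::finite) = d"
  shows "\<exists>\<beta> :: real \<Rightarrow> real.
    (\<forall>\<alpha>\<in>{0<..1}. \<beta> \<alpha> \<in> {0<..1}) \<and>
    (\<beta> \<longlongrightarrow> 1) (at 1 within {0<..1}) \<and>
    (\<forall>\<alpha>\<in>{0<..1}. \<forall>(J :: nat \<Rightarrow> nat set) (F :: nat \<Rightarrow> nat \<Rightarrow> (real ^ 'n) set).
       (\<forall>i\<in>{1..d+1}. finite (J i) \<and> J i \<noteq> {} \<and> (\<forall>j\<in>J i. convex (F i j))) \<longrightarrow>
       real (card (intersecting_colorful_tuples {1..d+1} J F))
         \<ge> \<alpha> * (\<Prod>i\<in>{1..d+1}. real (card (J i))) \<longrightarrow>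
       (\<exists>i\<in>{1..d+1}. \<exists>S\<subseteq>J i. intersecting S (F i) \<and>
          real (card S) \<ge> \<beta> \<alpha> * real (card (J i))))"
proof -
  define n where "n = d + 1"
  have n: "n > 0" "real n \<ge> 1" by (auto simp: n_def)
  define \<beta> where "\<beta> \<alpha> = max (\<alpha> / n) (1 - n * root n (1 - \<alpha>))" for \<alpha> :: real
  have "\<beta> \<alpha> \<in> {0<..1}" if "\<alpha> \<in> {0<..1}" for \<alpha>
  proof -
    have "\<alpha> / n > 0" "\<alpha> / n \<le> 1" "0 \<le> n * root n (1 - \<alpha>)"
      using that n by (auto simp: field_simps)
    then show ?thesis by (auto simp: \<beta>_def less_max_iff_disj)
  qed
  moreover have "(\<beta> \<longlongrightarrow> 1) (at 1 within {0<..1})"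
  proof -
    have "(\<beta> \<longlongrightarrow> max (1 / n) (1 - n * root n (1 - 1))) (at 1 within {0<..1})"
      unfolding \<beta>_def using n by (intro tendsto_intros) auto
    then show ?thesis using n by (simp add: max_def)
  qed
  moreover have "\<exists>i\<in>{1..d+1}. \<exists>S\<subseteq>J i. intersecting S (F i) \<and> real (card S) \<ge> \<beta> \<alpha> * real (card (J i))"
    if "\<alpha> \<in> {0<..1}"
      and "\<forall>i\<in>{1..d+1}. finite (J i) \<and> J i \<noteq> {} \<and> (\<forall>j\<in>J i. convex (F i j))"
      and "real (card (intersecting_colorful_tuples {1..d+1} J F))
         \<ge> \<alpha> * (\<Prod>i\<in>{1..d+1}. real (card (J i)))"
    for \<alpha> and J :: "nat \<Rightarrow> nat set" and F :: "nat \<Rightarrow> nat \<Rightarrow> (real ^ 'n) set"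
  proof -
    have dim: "DIM(real ^ 'n) + 1 = n" using assms by (simp add: n_def)
    show ?thesis
      by (rule colorful_fractional_Helly[of "{1..d+1}" J F \<alpha>, unfolded dim])
        (use that in \<open>auto simp: n_def \<beta>_def\<close>)
  qed
  ultimately show ?thesis by blast
qed

end
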